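(* Let $n_1>0$, $n_2>0$ and let $t_1,t_2$ be real numbers with $t_1+\frac{n_1}{2}-1>0$ and $t_2+\frac{n_2}{2}-1>0$. Let $X\sim KBeta(n_1,n_2,t_1,t_2)$, with cumulative distribution function $F_X$, and let $\alpha\in(0,1)$. Then the Beta-Kotz Value-at-Risk $VaR\beta_\alpha(X)$ of $X$ at probability level $\alpha$ is obtained by solving a hypergeometric equation: a number $v\in(0,1)$ satisfies $F_X(v)=\alpha$ (i.e. $v=VaR\beta_\alpha(X)$) if and only if $$C\,\frac{v^{\,t_1+\frac{n_1}{2}-1}}{t_1+\frac{n_1}{2}-1}\;{}_2F_1\!\left(t_1+\tfrac{n_1}{2}-1,\,-t_2-\tfrac{n_2}{2}+2;\;t_1+\tfrac{n_1}{2};\;v\right)-\alpha=0,$$ where $$C=\frac{\Gamma\left(t_1+t_2+\frac{n_1}{2}+\frac{n_2}{2}-2\right)}{\Gamma\left(t_1+\frac{n_1}{2}-1\right)\Gamma\left(t_2+\frac{n_2}{2}-1\right)}.$$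
   Context: The Beta-Kotz distribution $KBeta(n_1,n_2,t_1,t_2)$ is the distribution on $(0,1)$ with density $$\frac{\Gamma\left(t_1+t_2+\frac{n_1}{2}+\frac{n_2}{2}-2\right)}{\Gamma\left(t_1+\frac{n_1}{2}-1\right)\Gamma\left(t_2+\frac{n_2}{2}-1\right)}\,x^{(t_1+\frac{n_1}{2}-1)-1}(1-x)^{(t_2+\frac{n_2}{2}-1)-1},\qquad 0<x<1.$$ The Value-at-Risk of a random variable $X$ at level $\alpha\in(0,1)$ is a real number $VaR_\alpha(X)$ such that $F_X(VaR_\alpha(X))=P(X\le VaR_\alpha(X))=\alpha$; for a Beta-Kotz variable it is denoted $VaR\beta_\alpha(X)$. The Gauss hypergeometric function is ${}_2F_1(m,n;p;x)=\sum_{k=0}^\infty\frac{(m)_k(n)_k}{(p)_k\,k!}x^k$ for $|x|<1$, where $(m)_0=1$ and $(m)_k=m(m+1)\cdots(m+k-1)$ is the Pochhammer symbol. *)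

theory Defs
  imports "HOL-Probability.Probability"
begin

definition kbeta_density :: "real \<Rightarrow> real \<Rightarrow> real \<Rightarrow> real \<Rightarrow> real \<Rightarrow> real" where
  "kbeta_density n\<^sub>1 n\<^sub>2 t\<^sub>1 t\<^sub>2 x =
     (if 0 < x \<and> x < 1
      then Gamma (t\<^sub>1 + t\<^sub>2 + n\<^sub>1 / 2 + n\<^sub>2 / 2 - 2)
             / (Gamma (t\<^sub>1 + n\<^sub>1 / 2 - 1) * Gamma (t\<^sub>2 + n\<^sub>2 / 2 - 1))
           * x powr ((t\<^sub>1 + n\<^sub>1 / 2 - 1) - 1) * (1 - x) powr ((t\<^sub>2 + n\<^sub>2 / 2 - 1) - 1)
      else 0)"

text \<open>Value-at-Risk is a predicate on candidate values, since for a general random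
  variable a solution of \<open>F\<^sub>X(v) = \<alpha>\<close> need be neither existent nor unique.\<close>

definition is_VaR :: "'a measure \<Rightarrow> ('a \<Rightarrow> real) \<Rightarrow> real \<Rightarrow> real \<Rightarrow> bool" where
  "is_VaR M X \<alpha> v \<longleftrightarrow> cdf (distr M borel X) v = \<alpha>"

text \<open>Meaningful as a convergent series for \<open>\<bar>x\<bar> < 1\<close> and \<open>p\<close> not a nonpositive integer.\<close>

definition gauss_2F1 :: "real \<Rightarrow> real \<Rightarrow> real \<Rightarrow> real \<Rightarrow> real" where
  "gauss_2F1 m n p x =
     (\<Sum>k. pochhammer m k * pochhammer n k / (pochhammer p k * fact k) * x ^ k)"

lemma gauss_2F1_eq_eval_fps: "gauss_2F1 m n p x = eval_fps (fps_hypergeo [m, n] [p] 1) x"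
  by (simp add: gauss_2F1_def eval_fps_def fps_hypergeo_def)

end

theory Submission
  imports Defs
begin

text \<open>
  Since \<open>(a)\<^sub>k / (a + 1)\<^sub>k = a / (a + k)\<close>, the Euler operator \<open>a + x d/dx\<close> turns
  \<open>\<^sub>2F\<^sub>1(a, b; a + 1; x)\<close> into \<open>a\<close> times the binomial series of \<open>(1 - x)\<^sup>-\<^sup>b\<close>.  Hence
  \<open>x\<^sup>a / a \<cdot> \<^sub>2F\<^sub>1(a, b; a + 1; x)\<close> is an antiderivative of \<open>x\<^sup>a\<^sup>-\<^sup>1 (1 - x)\<^sup>-\<^sup>b\<close> that vanishes at
  \<open>0\<close>, and integrating the Beta-Kotz density up to \<open>v\<close> gives its distribution function in
  closed form.
\<close>

lemma pochhammer_plus1_ratio: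
  fixes a :: real
  assumes "a > 0"
  shows "pochhammer a k / pochhammer (a + 1) k = a / (a + real k)"
proof -
  have "pochhammer (a + 1) k > 0"
    using assms by (intro pochhammer_pos) auto
  \<comment> \<open>Both sides are \<open>pochhammer a (Suc k)\<close>, with the first or the last
    factor split off.\<close>
  moreover have "a * pochhammer (a + 1) k = (a + real k) * pochhammer a k"
    using pochhammer_rec[of a k] pochhammer_rec'[of a k] by simp
  ultimately show ?thesis
    using assms by (simp add: field_simps)
qed

text \<open>Newton's binomial series at \<open>- x\<close> with exponent \<open>- b\<close>: the
  sign in \<open>(- b) gchoose k\<close> cancels the one in \<open>(- x) ^ k\<close>.\<close>

lemma one_minus_powr_sums:
  fixes b x :: real
  assumes "\<bar>x\<bar> < 1"
  shows "(\<lambda>k. pochhammer b k / fact k * x ^ k) sums (1 - x) powr (- b)"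
proof -
  have "((- b) gchoose k) * (- x) ^ k = pochhammer b k / fact k * x ^ k" for k
  proof -
    have "((- b) gchoose k) * (- x) ^ k = pochhammer b k / fact k * ((- 1) ^ k * (- x) ^ k)"
      by (simp add: gbinomial_pochhammer)
    also have "(- 1) ^ k * (- x) ^ k = x ^ k"
      by (simp flip: power_mult_distrib)
    finally show ?thesis .
  qed
  then show ?thesis
    using gen_binomial_real[of "- x" "- b"] assms by simp
qed

text \<open>On power series the operator multiplies the \<open>k\<close>-th coefficient by
  \<open>a + k\<close>, which cancels the denominator of \<open>a / (a + k)\<close>. The derivative
  \<open>D\<close> stays implicit, since at \<open>x = 0\<close> the equation does not determine
  it.\<close>

lemma gauss_2F1_plus1_Euler_operator:
  fixes a b x :: real
  assumes a: "a > 0" and x: "\<bar>x\<bar> < 1"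
  obtains D where "(gauss_2F1 a b (a + 1) has_real_derivative D) (at x)"
    and "a * gauss_2F1 a b (a + 1) x + x * D = a * (1 - x) powr (- b)"
proof -
  define c where "c = (\<lambda>k. pochhammer b k / fact k)"
  define d where "d = (\<lambda>k. pochhammer a k * pochhammer b k / (pochhammer (a + 1) k * fact k))"
  have d: "d k = a / (a + real k) * c k" for k
    unfolding c_def d_def pochhammer_plus1_ratio[OF a, symmetric] by simp
  have c_sums: "(\<lambda>k. c k * y ^ k) sums (1 - y) powr (- b)" if "\<bar>y\<bar> < 1" for y
    using one_minus_powr_sums[OF that] by (simp add: c_def)
  have c_abs: "summable (\<lambda>k. norm (c k * y ^ k))" if y: "\<bar>y\<bar> < 1" for y
  proof -
    obtain z where "\<bar>y\<bar> < z" "z < 1"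
      using dense[OF y] by blast
    then show ?thesis
      by (intro powser_insidea[of _ z] sums_summable[OF c_sums]) auto
  qed
  have d_summable: "summable (\<lambda>k. d k * y ^ k)" if "norm y < 1" for y
  proof (rule summable_comparison_test')
    show "summable (\<lambda>k. norm (c k * y ^ k))"
      using that by (intro c_abs) auto
    \<comment> \<open>The factor \<open>a / (a + k)\<close> lies in \<open>(0, 1]\<close>, so the
      hypergeometric series is dominated by the binomial one.\<close>
    have "\<bar>d k\<bar> \<le> \<bar>c k\<bar>" for k
      using a mult_right_mono[of "a / (a + real k)" 1 "\<bar>c k\<bar>"] by (simp add: d abs_mult)
    then show "norm (d k * y ^ k) \<le> norm (c k * y ^ k)" for k
      by (simp add: abs_mult mult_right_mono)
  qed
  have gauss: "gauss_2F1 a b (a + 1) = (\<lambda>y. \<Sum>k. d k * y ^ k)"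
    by (simp add: fun_eq_iff gauss_2F1_def d_def)
  define D where "D = (\<Sum>k. diffs d k * x ^ k)"
  have "(gauss_2F1 a b (a + 1) has_real_derivative D) (at x)"
    unfolding gauss D_def using d_summable x by (intro termdiffs_strong'[of 1]) auto
  moreover have "a * gauss_2F1 a b (a + 1) x + x * D = a * (1 - x) powr (- b)"
  proof -
    have "summable (\<lambda>k. diffs d k * x ^ k)"
      using d_summable x by (intro termdiff_converges[of x 1]) auto
    then have "(\<lambda>k. x * (real k * d k * x ^ (k - Suc 0))) sums (x * D)"
      unfolding D_def by (intro sums_mult diffs_equiv)
    moreover have "(\<lambda>k. a * (d k * x ^ k)) sums (a * gauss_2F1 a b (a + 1) x)"
      unfolding gauss using d_summable x by (intro sums_mult summable_sums) auto
    ultimately have "(\<lambda>k. a * (d k * x ^ k) + x * (real k * d k * x ^ (k - Suc 0)))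
        sums (a * gauss_2F1 a b (a + 1) x + x * D)"
      by (intro sums_add)
    moreover have "a * (d k * x ^ k) + x * (real k * d k * x ^ (k - Suc 0)) = a * (c k * x ^ k)"
      for k
    proof -
      \<comment> \<open>At \<open>k = 0\<close> the truncated exponent is harmless, because the
        factor \<open>real k\<close> vanishes.\<close>
      have "x * (real k * d k * x ^ (k - Suc 0)) = real k * d k * x ^ k"
        by (cases k) auto
      moreover have "(a + real k) * d k = a * c k"
        using a by (simp add: d)
      ultimately show ?thesis
        by (metis (no_types, lifting) distrib_right mult.assoc)
    qed
    ultimately have "(\<lambda>k. a * (c k * x ^ k)) sums (a * gauss_2F1 a b (a + 1) x + x * D)"
      by simp
    moreover have "(\<lambda>k. a * (c k * x ^ k)) sums (a * (1 - x) powr (- b))"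
      using x by (intro sums_mult c_sums)
    ultimately show ?thesis
      by (rule sums_unique2)
  qed
  ultimately show ?thesis
    by (rule that)
qed

text \<open>For \<open>a < 1\<close> the integrand is unbounded near \<open>0\<close>. The
  antiderivative is therefore only shown continuous on the closed interval and differentiable inside
  it, which suffices for the fundamental theorem.\<close>

lemma has_integral_incomplete_Beta:
  fixes a b v :: real
  assumes a: "a > 0" and v: "0 \<le> v" "v < 1"
  shows "((\<lambda>x. x powr (a - 1) * (1 - x) powr (- b)) has_integral
    v powr a / a * gauss_2F1 a b (a + 1) v) {0..v}"
proof -
  define G where "G = (\<lambda>x. x powr a / a * gauss_2F1 a b (a + 1) x)"
  have "continuous_on {0..v} (gauss_2F1 a b (a + 1))"
  proof (rule continuous_at_imp_continuous_on, rule ballI)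
    fix x assume "x \<in> {0..v}"
    then show "isCont (gauss_2F1 a b (a + 1)) x"
      using v a by (auto intro: gauss_2F1_plus1_Euler_operator[of a x b] DERIV_isCont)
  qed
  then have "continuous_on {0..v} G"
    unfolding G_def using a by (intro continuous_intros continuous_on_powr') auto
  moreover have "(G has_vector_derivative x powr (a - 1) * (1 - x) powr (- b)) (at x)"
    if "x \<in> {0<..<v}" for x
  proof -
    have x: "0 < x" "\<bar>x\<bar> < 1"
      using that v by auto
    obtain D where D: "(gauss_2F1 a b (a + 1) has_real_derivative D) (at x)"
      and euler: "a * gauss_2F1 a b (a + 1) x + x * D = a * (1 - x) powr (- b)"
      using gauss_2F1_plus1_Euler_operator[OF a x(2)] by blast
    have "(G has_real_derivative
        x powr (a - 1) * gauss_2F1 a b (a + 1) x + x powr a / a * D) (at x)"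
      unfolding G_def using a x D by (auto intro!: derivative_eq_intros simp: add_divide_distrib mult.commute)
    \<comment> \<open>Pulling out \<open>x powr (a - 1) / a\<close> leaves exactly the Euler
      expression.\<close>
    moreover have "x powr a = x * x powr (a - 1)"
      using x by (simp add: powr_mult_base)
    then have "x powr (a - 1) * gauss_2F1 a b (a + 1) x + x powr a / a * D
        = x powr (a - 1) / a * (a * gauss_2F1 a b (a + 1) x + x * D)"
      using a by (simp add: field_simps)
    ultimately show ?thesis
      using a by (simp add: euler has_real_derivative_iff_has_vector_derivative)
  qed
  ultimately have "((\<lambda>x. x powr (a - 1) * (1 - x) powr (- b)) has_integral G v - G 0) {0..v}"
    using v by (intro fundamental_theorem_of_calculus_interior) auto
  then show ?thesis
    using a by (simp add: G_def)
qed

text \<open>As \<open>f\<close> vanishes below \<open>a\<close>, the half-line up to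
  \<open>v\<close> can be cut down to \<open>{a..v}\<close>. Nonnegativity of \<open>f\<close> turns
  the gauge integral into a Lebesgue integral and makes \<open>I\<close> nonnegative, so
  \<open>ennreal I\<close> loses nothing.\<close>

lemma cdf_eq_integral_density:
  fixes f :: "real \<Rightarrow> real"
  assumes X: "distributed M lborel X (\<lambda>x. ennreal (f x))"
    and f: "\<And>x. 0 \<le> f x" "\<And>x. x < a \<Longrightarrow> f x = 0"
    and I: "(f has_integral I) {a..v}"
  shows "cdf (distr M borel X) v = I"
proof -
  have "X \<in> borel_measurable M"
    using distributed_measurable[OF X] by simp
  then have "cdf (distr M borel X) v = measure M (X -` {..v} \<inter> space M)"
    by (simp add: cdf_def measure_distr)
  moreover have "emeasure M (X -` {..v} \<inter> space M) = ennreal I"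
  proof -
    have "emeasure M (X -` {..v} \<inter> space M) = (\<integral>\<^sup>+x. ennreal (f x) * indicator {..v} x \<partial>lborel)"
      using X by (rule distributed_emeasure) simp
    also have "\<dots> = (\<integral>\<^sup>+x. ennreal (f x) * indicator {a..v} x \<partial>lborel)"
      by (intro nn_integral_cong) (auto simp: indicator_def f(2) not_le)
    also have "\<dots> = ennreal I"
      using f(1) I by (rule nn_integral_has_integral_lebesgue')
    finally show ?thesis .
  qed
  ultimately show ?thesis
    using has_integral_nonneg[OF I] f(1) by (simp add: measure_def)
qed

theorem theorem4p1:
  fixes M :: "'a measure" and X :: "'a \<Rightarrow> real"
    and n\<^sub>1 n\<^sub>2 t\<^sub>1 t\<^sub>2 \<alpha> C v :: real
  assumes "prob_space M"
    and "n\<^sub>1 > 0" and "n\<^sub>2 > 0"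
    and "t\<^sub>1 + n\<^sub>1 / 2 - 1 > 0" and "t\<^sub>2 + n\<^sub>2 / 2 - 1 > 0"
    and "distributed M lborel X (\<lambda>x. ennreal (kbeta_density n\<^sub>1 n\<^sub>2 t\<^sub>1 t\<^sub>2 x))"
    and "0 < \<alpha>" and "\<alpha> < 1"
    and "C = Gamma (t\<^sub>1 + t\<^sub>2 + n\<^sub>1 / 2 + n\<^sub>2 / 2 - 2)
               / (Gamma (t\<^sub>1 + n\<^sub>1 / 2 - 1) * Gamma (t\<^sub>2 + n\<^sub>2 / 2 - 1))"
    and "0 < v" and "v < 1"
  shows "is_VaR M X \<alpha> v \<longleftrightarrow>
    C * (v powr (t\<^sub>1 + n\<^sub>1 / 2 - 1) / (t\<^sub>1 + n\<^sub>1 / 2 - 1))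
      * gauss_2F1 (t\<^sub>1 + n\<^sub>1 / 2 - 1) (- t\<^sub>2 - n\<^sub>2 / 2 + 2) (t\<^sub>1 + n\<^sub>1 / 2) v - \<alpha> = 0"
proof -
  define a where "a = t\<^sub>1 + n\<^sub>1 / 2 - 1"
  define b where "b = t\<^sub>2 + n\<^sub>2 / 2 - 1"
  define f where "f = kbeta_density n\<^sub>1 n\<^sub>2 t\<^sub>1 t\<^sub>2"
  have a: "a > 0" and b: "b > 0"
    using assms by (simp_all add: a_def b_def)
  have C: "C = Gamma (a + b) / (Gamma a * Gamma b)"
    using assms(9) by (simp add: a_def b_def algebra_simps)
  have f: "f x = (if 0 < x \<and> x < 1 then C * x powr (a - 1) * (1 - x) powr (b - 1) else 0)" for x
    unfolding f_def kbeta_density_def a_def b_def assms(9) ..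
  have "C > 0"
    using a b by (simp add: C Gamma_real_pos)
  then have f_nonneg: "0 \<le> f x" for x
    by (simp add: f)
  \<comment> \<open>The exponent \<open>b - 1\<close> is written as \<open>- (1 - b)\<close>, so
    \<open>1 - b\<close> becomes the second hypergeometric parameter.\<close>
  have "((\<lambda>x. C * (x powr (a - 1) * (1 - x) powr (- (1 - b)))) has_integral
      C * (v powr a / a * gauss_2F1 a (1 - b) (a + 1) v)) {0..v}"
    using a assms by (intro has_integral_mult_right has_integral_incomplete_Beta) auto
  then have "(f has_integral C * (v powr a / a * gauss_2F1 a (1 - b) (a + 1) v)) {0..v}"
    \<comment> \<open>The integrands agree even at \<open>x = 0\<close>, where
      \<open>0 powr (a - 1)\<close> is \<open>0\<close> by convention.\<close>
    by (rule has_integral_eq[rotated]) (use assms in \<open>auto simp: f\<close>)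
  moreover have "distributed M lborel X (\<lambda>x. ennreal (f x))"
    using assms(6) by (simp add: f_def)
  ultimately have "cdf (distr M borel X) v = C * (v powr a / a * gauss_2F1 a (1 - b) (a + 1) v)"
    by (intro cdf_eq_integral_density[of M X f 0] f_nonneg) (auto simp: f)
  moreover have "1 - b = - t\<^sub>2 - n\<^sub>2 / 2 + 2" "a + 1 = t\<^sub>1 + n\<^sub>1 / 2"
    by (simp_all add: a_def b_def)
  ultimately show ?thesis
    by (simp add: is_VaR_def mult.assoc flip: a_def)
qed

end
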